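(* Let $c^{(0^2)}$ denote the critical wave speed at which the linearized system exhibits a Hamiltonian $0^2$ resonance, and define the critical effective gravity $g_*^{(0^2)}=g-2\Omega c^{(0^2)}$. For any family of laminar flows satisfying $a(\zeta)\ge a_{\min}>0$ uniformly (i.e. for all $\zeta\in[0,1]$ and all members of the family, with $a_{\min}$ independent of the member), the corresponding $0^2$ critical effective gravity is bounded away from zero. Consequently, $g_*^{(0^2)}\to0$ can occur only along a family for which $\min_{\zeta\in[0,1]}a(\zeta)\to0$, equivalently, along which the laminar flow approaches stagnation ($\inf_D(u-c)\to0$).
   Context: **Setting.** Steady two-dimensional $f$-plane capillary-gravity flow with gravity $g$, rotation rate $\Omega$, wave speed $c$, effective gravity $g_*=g-2\Omega c$, fixed depth $d>0$ and fixed relative mass flux $m<0$, surface tension $\sigma>0$; dimensionless parameters $\alpha=g_*d^3/m^2$, $\beta=\sigma d/m^2$. Fluid domain of the laminar flow: $D=\{-d<z<0\}$; $u$ is the horizontal velocity, and $\psi$ with $\psi_z=u-c>0$, $\psi=0$ on the surface, $\psi=m$ on the bed, is the stream function. **Laminar flows.** Let $\zeta\in[0,1]$ be the dimensionless stream variable, $\psi=m(1-\zeta)$ ($\zeta=0$ bed, $\zeta=1$ surface), $\gamma\in L^2(0,1)$ the dimensionless vorticity function, $\Gamma(\zeta)=\int_0^\zeta\gamma$. A laminar flow is $H(\zeta)=\int_0^\zeta a(s)^{-1}ds$ (dimensionless height above the bed), $a(\zeta)=\sqrt{\lambda+2\Gamma(\zeta)}>0$, with $\lambda$ chosen so that $H(1)=\int_0^1a^{-1}=1$.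 Up to the fixed scaling factor $|m|/d$, $a=\psi_z=u-c$. **Linearized operator and resonance.** For given $a$ and $(\beta,\alpha)$, $\mathcal L(\rho,\tau,\phi,\mathfrak w)=\big(-a(1)^{-1}\tau,\ a(1)^4\beta^{-1}\phi_\zeta(1)-a(1)\alpha\beta^{-1}\rho,\ -a^{-1}\mathfrak w,\ (a^3\phi_\zeta)_\zeta\big)$ on $\{(\rho,\tau,\phi,\mathfrak w)\in\mathbb R\times\mathbb R\times H^1(0,1)\times L^2(0,1):\phi(0)=0,\ \phi(1)=\rho\}$, with domain $\phi\in H^2(0,1)$, $\mathfrak w\in H^1(0,1)$, $\phi(0)=0$, $\phi(1)=\rho$, $\mathfrak w(0)=0$, $\mathfrak w(1)=\tau$. The Hamiltonian $0^2$ resonance occurs when $0$ is an eigenvalue of $\mathcal L$ of algebraic multiplicity two; $c^{(0^2)}$ is the wave speed for which the value $\alpha=(g-2\Omega c)d^3/m^2$ yields this resonance (with $\beta$ different from the exceptional value $\beta_*$ at which the multiplicity of $0$ is four). *)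

theory Defs
  imports "HOL-Analysis.Analysis"
begin

section \<open>The space \<open>L\<^sup>2(0,1)\<close>\<close>

definition L2_fun :: "(real \<Rightarrow> real) \<Rightarrow> bool" where
  "L2_fun f \<longleftrightarrow> f \<in> borel_measurable (lebesgue_on {0..1}) \<and>
               integrable (lebesgue_on {0..1}) (\<lambda>x. (f x)\<^sup>2)"

definition L2_rel :: "(real \<Rightarrow> real) \<Rightarrow> (real \<Rightarrow> real) \<Rightarrow> bool" where
  "L2_rel f g \<longleftrightarrow> L2_fun f \<and> L2_fun g \<and> (AE x in lebesgue_on {0..1}. f x = g x)"

lemma L2_fun_zero: "L2_fun (\<lambda>x. 0)"
  by (simp add: L2_fun_def)

lemma L2_fun_scale: "L2_fun f \<Longrightarrow> L2_fun (\<lambda>x. k * f x)"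
  by (auto simp: L2_fun_def power_mult_distrib)

lemma L2_fun_add:
  assumes f: "L2_fun f" and g: "L2_fun g"
  shows "L2_fun (\<lambda>x. f x + g x)"
proof -
  note [measurable] = f[unfolded L2_fun_def, THEN conjunct1] g[unfolded L2_fun_def, THEN conjunct1]
  have i: "integrable (lebesgue_on {0..1}) (\<lambda>x. 2 * (f x)\<^sup>2 + 2 * (g x)\<^sup>2)"
    using f g by (auto simp: L2_fun_def)
  have b: "(f x + g x)\<^sup>2 \<le> 2 * (f x)\<^sup>2 + 2 * (g x)\<^sup>2" for x
    using zero_le_power2[of "f x - g x"] by (simp add: power2_eq_square algebra_simps)
  have "integrable (lebesgue_on {0..1}) (\<lambda>x. (f x + g x)\<^sup>2)"
    by (rule Bochner_Integration.integrable_bound[OF i]) (use b in \<open>auto intro!: AE_I2\<close>)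
  then show ?thesis
    using f g by (auto simp: L2_fun_def intro: borel_measurable_add)
qed

lemma L2_fun_uminus: "L2_fun f \<Longrightarrow> L2_fun (\<lambda>x. - f x)"
  using L2_fun_scale[of f "-1"] by simp

lemma L2_fun_diff: "L2_fun f \<Longrightarrow> L2_fun g \<Longrightarrow> L2_fun (\<lambda>x. f x - g x)"
  using L2_fun_add[of f "\<lambda>x. - g x"] L2_fun_uminus[of g] by simp

quotient_type L2 = "real \<Rightarrow> real" / partial: L2_rel
proof (rule part_equivpI)
  show "\<exists>f. L2_rel f f"
    using L2_fun_zero by (auto simp: L2_rel_def)
  show "symp L2_rel"
    unfolding symp_def L2_rel_def by (simp add: eq_commute)
  show "transp L2_rel"
  proof (rule transpI)
    fix f g h assume "L2_rel f g" and "L2_rel g h"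
    then show "L2_rel f h"
      unfolding L2_rel_def by auto
  qed
qed

instantiation L2 :: real_vector
begin

lift_definition zero_L2 :: L2 is "\<lambda>x. 0"
  by (simp add: L2_rel_def L2_fun_zero)

lift_definition plus_L2 :: "L2 \<Rightarrow> L2 \<Rightarrow> L2" is "\<lambda>f g x. f x + g x"
  by (auto simp: L2_rel_def L2_fun_add)

lift_definition uminus_L2 :: "L2 \<Rightarrow> L2" is "\<lambda>f x. - f x"
  by (auto simp: L2_rel_def L2_fun_uminus)

lift_definition minus_L2 :: "L2 \<Rightarrow> L2 \<Rightarrow> L2" is "\<lambda>f g x. f x - g x"
  by (auto simp: L2_rel_def L2_fun_diff)

lift_definition scaleR_L2 :: "real \<Rightarrow> L2 \<Rightarrow> L2" is "\<lambda>k f x. k * f x"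
  by (auto simp: L2_rel_def L2_fun_scale)

instance
proof
  fix f g h :: L2 and k l :: real
  show "f + g + h = f + (g + h)"
    by transfer (simp add: L2_rel_def L2_fun_add add.assoc)
  show "f + g = g + f"
    by transfer (simp add: L2_rel_def L2_fun_add add.commute)
  show "0 + f = f"
    by transfer (simp add: L2_rel_def)
  show "- f + f = 0"
    by transfer (simp add: L2_rel_def L2_fun_zero)
  show "f - g = f + - g"
    by transfer (simp add: L2_rel_def L2_fun_diff)
  show "k *\<^sub>R (f + g) = k *\<^sub>R f + k *\<^sub>R g"
    by transfer (simp add: L2_rel_def L2_fun_add L2_fun_scale distrib_left)
  show "(k + l) *\<^sub>R f = k *\<^sub>R f + l *\<^sub>R f"
    by transfer (simp add: L2_rel_def L2_fun_add L2_fun_scale distrib_right)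
  show "k *\<^sub>R l *\<^sub>R f = (k * l) *\<^sub>R f"
    by transfer (auto simp: L2_rel_def mult.assoc intro: L2_fun_scale)
  show "1 *\<^sub>R f = f"
    by transfer (simp add: L2_rel_def)
qed

end

text \<open>Multiplication by a bounded measurable function on \<open>[0,1]\<close>.\<close>

definition L2_mult :: "(real \<Rightarrow> real) \<Rightarrow> L2 \<Rightarrow> L2" where
  "L2_mult q f = abs_L2 (\<lambda>x. q x * rep_L2 f x)"


section \<open>The Sobolev spaces \<open>H\<^sup>1(0,1)\<close> and \<open>H\<^sup>2(0,1)\<close>\<close>

text \<open>
  In one dimension, \<open>H\<^sup>1(0,1)\<close> consists of the classes of absolutely continuous functions on
  \<open>[0,1]\<close> with square-integrable derivative, i.e. of the indefinite integrals of
  \<open>L\<^sup>2\<close> functions. The function \<open>F\<close> below is determined on \<open>[0,1]\<close> by its class, and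
  provides the boundary values; \<open>v\<close> is determined almost everywhere.
\<close>

definition H1_pair :: "(real \<Rightarrow> real) \<Rightarrow> (real \<Rightarrow> real) \<Rightarrow> bool" where
  "H1_pair F v \<longleftrightarrow> L2_fun F \<and> L2_fun v \<and>
     (\<forall>x\<in>{0..1}. F x = F 0 + integral\<^sup>L (lebesgue_on {0..x}) v)"

definition H1 :: "L2 set" where
  "H1 = {f. \<exists>F v. H1_pair F v \<and> f = abs_L2 F}"

definition cont_rep :: "L2 \<Rightarrow> real \<Rightarrow> real" where
  "cont_rep f = (SOME F. (\<exists>v. H1_pair F v) \<and> f = abs_L2 F)"

definition weak_deriv :: "L2 \<Rightarrow> L2" where
  "weak_deriv f = (THE f'. \<exists>F v. H1_pair F v \<and> f = abs_L2 F \<and> f' = abs_L2 v)"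

definition H2 :: "L2 set" where
  "H2 = {f \<in> H1. weak_deriv f \<in> H1}"


section \<open>Algebraic multiplicity of eigenvalues\<close>

text \<open>An unbounded linear operator is given by its domain \<open>D\<close> and a map \<open>T\<close>, of which only
  the values on \<open>D\<close> matter.\<close>

definition is_eigenvalue ::
  "'v::real_vector set \<Rightarrow> ('v \<Rightarrow> 'v) \<Rightarrow> real \<Rightarrow> bool" where
  "is_eigenvalue D T \<mu> \<longleftrightarrow> (\<exists>v\<in>D. v \<noteq> 0 \<and> T v = \<mu> *\<^sub>R v)"

text \<open>The kernel of \<open>(T - \<mu>)\<^sup>n\<close> on its natural domain.\<close>

primrec ker_power ::
  "'v::real_vector set \<Rightarrow> ('v \<Rightarrow> 'v) \<Rightarrow> real \<Rightarrow> nat \<Rightarrow> 'v set" where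
  "ker_power D T \<mu> 0 = {0}"
| "ker_power D T \<mu> (Suc n) = {v \<in> D. T v - \<mu> *\<^sub>R v \<in> ker_power D T \<mu> n}"

text \<open>Since \<^const>\<open>dim\<close> is \<open>0\<close> for infinite-dimensional spaces, a positive value certifies a
  finite-dimensional generalized eigenspace.\<close>

definition alg_multiplicity ::
  "'v::real_vector set \<Rightarrow> ('v \<Rightarrow> 'v) \<Rightarrow> real \<Rightarrow> nat" where
  "alg_multiplicity D T \<mu> = dim (\<Union>n. ker_power D T \<mu> n)"


section \<open>Laminar flows\<close>

definition Gam :: "(real \<Rightarrow> real) \<Rightarrow> real \<Rightarrow> real" where
  "Gam \<gamma> \<zeta> = integral\<^sup>L (lebesgue_on {0..\<zeta>}) \<gamma>"

definition flow_a :: "(real \<Rightarrow> real) \<Rightarrow> real \<Rightarrow> real \<Rightarrow> real" where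
  "flow_a \<gamma> lam \<zeta> = sqrt (lam + 2 * Gam \<gamma> \<zeta>)"

definition height :: "(real \<Rightarrow> real) \<Rightarrow> real \<Rightarrow> real" where
  "height a \<zeta> = integral\<^sup>L (lebesgue_on {0..\<zeta>}) (\<lambda>s. 1 / a s)"

definition laminar_flow :: "(real \<Rightarrow> real) \<Rightarrow> real \<Rightarrow> bool" where
  "laminar_flow \<gamma> lam \<longleftrightarrow> L2_fun \<gamma> \<and>
     (\<forall>\<zeta>\<in>{0..1}. lam + 2 * Gam \<gamma> \<zeta> > 0) \<and> height (flow_a \<gamma> lam) 1 = 1"

text \<open>The physical flow: points are \<open>(x, z)\<close>, and the streamline \<open>\<psi> = m (1 - \<zeta>)\<close> lies at
  \<open>z = -d + d H(\<zeta>)\<close>, where \<open>H = height a\<close>. The horizontal velocity \<open>u\<close> satisfies \<open>u - c = \<psi>\<^sub>z\<close>.\<close>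

definition fluid_domain :: "real \<Rightarrow> (real \<times> real) set" where
  "fluid_domain d = {(x, z). - d < z \<and> z < 0}"

definition stream_function ::
  "real \<Rightarrow> real \<Rightarrow> (real \<Rightarrow> real) \<Rightarrow> real \<times> real \<Rightarrow> real" where
  "stream_function d m a = (\<lambda>(x, z). m * (1 - the_inv_into {0..1} (height a) ((z + d) / d)))"

definition horizontal_velocity ::
  "real \<Rightarrow> real \<Rightarrow> (real \<Rightarrow> real) \<Rightarrow> real \<Rightarrow> real \<times> real \<Rightarrow> real" where
  "horizontal_velocity d m a c = (\<lambda>(x, z). c + deriv (\<lambda>y. stream_function d m a (x, y)) z)"


section \<open>The linearized operator and the resonance\<close>

type_synonym state = "real \<times> real \<times> L2 \<times> L2"

definition state_space :: "state set" where
  "state_space = {(\<rho>, \<tau>, \<phi>, w). \<phi> \<in> H1 \<and> cont_rep \<phi> 0 = 0 \<and> cont_rep \<phi> 1 = \<rho>}"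

definition lin_dom :: "state set" where
  "lin_dom = {(\<rho>, \<tau>, \<phi>, w). (\<rho>, \<tau>, \<phi>, w) \<in> state_space \<and> \<phi> \<in> H2 \<and> w \<in> H1 \<and>
                cont_rep w 0 = 0 \<and> cont_rep w 1 = \<tau>}"

definition lin_op :: "(real \<Rightarrow> real) \<Rightarrow> real \<Rightarrow> real \<Rightarrow> state \<Rightarrow> state" where
  "lin_op a \<beta> \<alpha> = (\<lambda>(\<rho>, \<tau>, \<phi>, w).
     (- (\<tau> / a 1),
      (a 1) ^ 4 / \<beta> * cont_rep (weak_deriv \<phi>) 1 - a 1 * \<alpha> / \<beta> * \<rho>,
      L2_mult (\<lambda>\<zeta>. - (1 / a \<zeta>)) w,
      weak_deriv (L2_mult (\<lambda>\<zeta>. (a \<zeta>) ^ 3) (weak_deriv \<phi>))))"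

definition zero_sq_resonance :: "(real \<Rightarrow> real) \<Rightarrow> real \<Rightarrow> real \<Rightarrow> bool" where
  "zero_sq_resonance a \<beta> \<alpha> \<longleftrightarrow>
     is_eigenvalue lin_dom (lin_op a \<beta> \<alpha>) 0 \<and> alg_multiplicity lin_dom (lin_op a \<beta> \<alpha>) 0 = 2"

definition eff_gravity :: "real \<Rightarrow> real \<Rightarrow> real \<Rightarrow> real" where
  "eff_gravity g \<Omega> c = g - 2 * \<Omega> * c"

definition alpha_par :: "real \<Rightarrow> real \<Rightarrow> real \<Rightarrow> real \<Rightarrow> real \<Rightarrow> real" where
  "alpha_par g \<Omega> d m c = eff_gravity g \<Omega> c * d ^ 3 / m\<^sup>2"

definition beta_par :: "real \<Rightarrow> real \<Rightarrow> real \<Rightarrow> real" where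
  "beta_par \<sigma> d m = \<sigma> * d / m\<^sup>2"

text \<open>The requirement of multiplicity exactly two excludes the exceptional value of \<open>\<beta>\<close>, at
  which the multiplicity is four.\<close>

definition critical_speed ::
  "real \<Rightarrow> real \<Rightarrow> real \<Rightarrow> real \<Rightarrow> real \<Rightarrow> (real \<Rightarrow> real) \<Rightarrow> real \<Rightarrow> bool" where
  "critical_speed g \<Omega> d m \<sigma> a c \<longleftrightarrow>
     zero_sq_resonance a (beta_par \<sigma> d m) (alpha_par g \<Omega> d m c)"

end

theory Submission
  imports Defs
begin

text \<open>
  If \<open>(\<rho>, \<tau>, \<phi>, w)\<close> is a nonzero null vector of the linearized operator, then \<open>\<tau>\<close> and \<open>w\<close> vanish and
  \<open>a\<^sup>3 \<phi>'\<close> is a constant \<open>K \<noteq> 0\<close>; the boundary condition at \<open>\<zeta> = 1\<close> then reads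
  \<open>K = \<alpha> \<rho> = \<alpha> K \<integral> a\<^sup>-\<^sup>3\<close>. Hence a resonance forces \<open>\<alpha> = 1 / \<integral> a\<^sup>-\<^sup>3 \<ge> (min a)\<^sup>3\<close>. The physical velocity
  satisfies \<open>u - c = (\<bar>m\<bar> / d) a\<close> along streamlines, so its infimum is a fixed multiple of \<open>min a\<close>.
\<close>

section \<open>Indefinite integrals of square-integrable functions\<close>

lemma absolutely_integrable_on_iff_integrable_lebesgue_on:
  fixes f :: "real \<Rightarrow> real"
  assumes "S \<in> sets lebesgue"
  shows "f absolutely_integrable_on S \<longleftrightarrow> integrable (lebesgue_on S) f"
  using assms by (simp add: set_integrable_def integrable_restrict_space)

text \<open>The interval has finite measure, so \<open>1 + (v x)\<^sup>2\<close> is an integrable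
  majorant of \<open>\<bar>v x\<bar>\<close>.\<close>

lemma L2_fun_absolutely_integrable:
  assumes "L2_fun v"
  shows "v absolutely_integrable_on {0..1}"
proof -
  have i: "integrable (lebesgue_on {0..1}) (\<lambda>x. 1 + (v x)\<^sup>2)"
    using assms by (auto simp: L2_fun_def intro!: Bochner_Integration.integrable_add)
  have b: "norm (v x) \<le> norm (1 + (v x)\<^sup>2)" for x
    using zero_le_power2[of "\<bar>v x\<bar> - 1"] zero_le_power2[of "v x"]
    unfolding power2_diff by (simp add: real_norm_def abs_if split: if_splits)
  have "integrable (lebesgue_on {0..1}) v"
    by (rule Bochner_Integration.integrable_bound[OF i]) (use assms b in \<open>auto simp: L2_fun_def\<close>)
  then show ?thesis
    by (simp add: absolutely_integrable_on_iff_integrable_lebesgue_on)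
qed

lemma lebesgue_on_integral_eq:
  fixes v :: "real \<Rightarrow> real"
  assumes "v absolutely_integrable_on {0..1}" "x \<in> {0..1}"
  shows "integral\<^sup>L (lebesgue_on {0..x}) v = integral {0..x} v"
proof (rule lebesgue_integral_eq_integral)
  have "v absolutely_integrable_on {0..x}"
    by (rule set_integrable_subset[OF assms(1)]) (use assms(2) in auto)
  then show "integrable (lebesgue_on {0..x}) v"
    by (simp add: absolutely_integrable_on_iff_integrable_lebesgue_on)
qed auto

lemma H1_pair_integral:
  assumes "H1_pair F v" "x \<in> {0..1}"
  shows "F x = F 0 + integral {0..x} v"
  using assms lebesgue_on_integral_eq[OF L2_fun_absolutely_integrable, of v x]
  unfolding H1_pair_def by metis

lemma continuous_on_H1_pair:
  assumes "H1_pair F v"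
  shows "continuous_on {0..1} F"
proof -
  have "v integrable_on {0..1}"
    using assms L2_fun_absolutely_integrable set_lebesgue_integral_eq_integral(1)
    by (auto simp: H1_pair_def)
  then have "continuous_on {0..1} (\<lambda>x. F 0 + integral {0..x} v)"
    by (intro continuous_intros indefinite_integral_continuous_1)
  then show ?thesis
    by (rule continuous_on_eq) (rule H1_pair_integral[OF assms, symmetric])
qed

lemma L2_fun_continuous_mult:
  assumes "continuous_on {0..1} q" "L2_fun v"
  shows "L2_fun (\<lambda>x. q x * v x)"
proof -
  have q: "q \<in> borel_measurable (lebesgue_on {0..1})"
    by (rule continuous_imp_measurable_on_sets_lebesgue[OF assms(1)]) auto
  have v: "v \<in> borel_measurable (lebesgue_on {0..1})" "integrable (lebesgue_on {0..1}) (\<lambda>x. (v x)\<^sup>2)"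
    using assms(2) by (auto simp: L2_fun_def)
  obtain B where B: "\<And>x. x \<in> {0..1} \<Longrightarrow> \<bar>q x\<bar> \<le> B" 
    using compact_imp_bounded[OF compact_continuous_image[OF assms(1)]]
    unfolding bounded_iff by (metis compact_Icc imageI real_norm_def)
  have i: "integrable (lebesgue_on {0..1}) (\<lambda>x. B\<^sup>2 * (v x)\<^sup>2)"
    using v by simp
  have b: "norm ((q x * v x)\<^sup>2) \<le> norm (B\<^sup>2 * (v x)\<^sup>2)" if "x \<in> {0..1}" for x
    using B[OF that] by (simp add: power_mult_distrib mult_right_mono flip: abs_le_square_iff)
  have "integrable (lebesgue_on {0..1}) (\<lambda>x. (q x * v x)\<^sup>2)"
    by (rule Bochner_Integration.integrable_bound[OF i]) (use q v b in \<open>auto intro!: AE_I2\<close>)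
  then show ?thesis
    using q v by (simp add: L2_fun_def)
qed

lemma L2_fun_continuous: "continuous_on {0..1} q \<Longrightarrow> L2_fun q"
  using L2_fun_continuous_mult[of q "\<lambda>_. 1"] by (simp add: L2_fun_def)

text \<open>An indefinite integral is continuous on \<open>{0..1}\<close> and hence square
  integrable, which supplies the part \<open>L2_fun F\<close> of \<open>H1_pair\<close>. The gauge
  integral stands in for the Lebesgue integral so that the calculus of adjacent intervals applies
  directly.\<close>

lemma H1_pairI:
  assumes "L2_fun v" and "\<And>x. x \<in> {0..1} \<Longrightarrow> F x = F 0 + integral {0..x} v"
  shows "H1_pair F v"
proof -
  have "v integrable_on {0..1}"
    using L2_fun_absolutely_integrable[OF assms(1)] set_lebesgue_integral_eq_integral(1) by blast
  then have "continuous_on {0..1} (\<lambda>x. F 0 + integral {0..x} v)"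
    by (intro continuous_intros indefinite_integral_continuous_1)
  then have "continuous_on {0..1} F"
    by (rule continuous_on_eq) (rule assms(2)[symmetric])
  then show ?thesis
    using assms lebesgue_on_integral_eq[OF L2_fun_absolutely_integrable[OF assms(1)]]
    unfolding H1_pair_def by (metis L2_fun_continuous)
qed

section \<open>Functions determined by their integrals or by their values almost everywhere\<close>

text \<open>By Lebesgue differentiation, the averages of \<open>v\<close> over
  \<open>{x..x + h}\<close> tend to \<open>v x\<close> off a negligible set, and all these averages
  vanish.\<close>

lemma AE_zero_if_integrals_zero:
  fixes v :: "real \<Rightarrow> real"
  assumes v: "v absolutely_integrable_on {0..1}"
    and z: "\<And>x. x \<in> {0..1} \<Longrightarrow> integral {0..x} v = 0"
  shows "AE x in lebesgue_on {0..1}. v x = 0"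
proof -
  \<comment> \<open>Extension by zero, since the differentiation theorem concerns functions on the
    whole line.\<close>
  define w where "w x = (if x \<in> {0..1} then v x else 0)" for x
  have "v integrable_on {0..1}"
    using v set_lebesgue_integral_eq_integral(1) by blast
  then have "w integrable_on UNIV"
    unfolding w_def by (simp only: integrable_restrict_UNIV)
  then have "w integrable_on cbox a b" for a b
    using integrable_on_subcbox by blast
  then obtain N where N: "negligible N" 
    "\<And>x e. \<lbrakk>x \<notin> N; 0 < e\<rbrakk> \<Longrightarrow> \<exists>d>0. \<forall>h. 0 < h \<and> h < d \<longrightarrow>
        norm (integral (cbox x (x + h *\<^sub>R One)) w /\<^sub>R h ^ DIM(real) - w x) < e"
    using integrable_ccontinuous_explicit[of w] by metis
  have "w x = 0" if x: "x \<in> {0..<1} - N" for x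
  proof (rule ccontr)
    assume "w x \<noteq> 0"
    then obtain d where d: "d > 0" "\<And>h. 0 < h \<Longrightarrow> h < d \<Longrightarrow>
        norm (integral (cbox x (x + h *\<^sub>R One)) w /\<^sub>R h ^ DIM(real) - w x) < norm (w x)"
      using N(2)[of x "norm (w x)"] x by auto
    \<comment> \<open>Short enough that \<open>{x..x + h}\<close> stays inside
      \<open>{0..1}\<close>, where \<open>w\<close> agrees with \<open>v\<close>; halving
      \<open>d\<close> makes \<open>h < d\<close> strict.\<close>
    define h where "h = min (d / 2) (1 - x)"
    have h: "0 < h" "h < d" "x + h \<le> 1"
      using d x by (auto simp: h_def min_def)
    have "integral {x..x + h} w = integral {x..x + h} v"
      by (rule integral_cong) (use h x in \<open>auto simp: w_def\<close>)
    moreover have "integral {0..x} v + integral {x..x + h} v = integral {0..x + h} v"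
      by (rule Henstock_Kurzweil_Integration.integral_combine)
        (use h x \<open>v integrable_on {0..1}\<close> in \<open>auto intro: integrable_on_subinterval\<close>)
    moreover have "integral {0..x} v = 0" "integral {0..x + h} v = 0"
      using z h x by auto
    ultimately show False
      using d(2)[of h] h by simp
  qed
  then have "v x = 0" if "x \<in> {0..1}" "x \<notin> N \<union> {1}" for x
    using that by (auto simp: w_def dest: spec[of _ x])
  then have "{x \<in> space lebesgue. \<not> (x \<in> {0..1} \<longrightarrow> v x = 0)} \<subseteq> N \<union> {1}"
    by blast
  moreover have "N \<union> {1} \<in> null_sets lebesgue"
    using N(1) by (simp flip: negligible_iff_null_sets)
  ultimately have "AE x in lebesgue. x \<in> {0..1} \<longrightarrow> v x = 0"
    by (intro AE_I'[of "N \<union> {1}"])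
  then show ?thesis
    by (simp add: AE_restrict_space_iff)
qed

text \<open>The function \<open>\<bar>F x - G x\<bar>\<close> is continuous and nonnegative with
  integral zero, so it vanishes everywhere on the interval.\<close>

lemma continuous_AE_eq:
  fixes F G :: "real \<Rightarrow> real"
  assumes FG: "continuous_on {0..1} F" "continuous_on {0..1} G"
    and ae: "AE x in lebesgue_on {0..1}. F x = G x" and x: "x \<in> {0..1}"
  shows "F x = G x"
proof -
  have c: "continuous_on {0..1} (\<lambda>x. \<bar>F x - G x\<bar>)"
    using FG by (intro continuous_intros)
  have i: "integrable (lebesgue_on {0..1}) (\<lambda>x. \<bar>F x - G x\<bar>)"
    using L2_fun_absolutely_integrable[OF L2_fun_continuous[OF c]]
    by (simp add: absolutely_integrable_on_iff_integrable_lebesgue_on)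
  have "integral {0..1} (\<lambda>x. \<bar>F x - G x\<bar>) = integral\<^sup>L (lebesgue_on {0..1}) (\<lambda>x. \<bar>F x - G x\<bar>)"
    using lebesgue_integral_eq_integral[OF i] by simp
  also have "\<dots> = 0"
    by (rule integral_eq_zero_AE) (use ae in auto)
  finally show ?thesis
    using integral_eq_0_iff[OF c] x by auto
qed

section \<open>Weak derivatives\<close>

lemma L2_fun_H1_pair: "H1_pair F v \<Longrightarrow> L2_fun F" "H1_pair F v \<Longrightarrow> L2_fun v"
  by (simp_all add: H1_pair_def)

lemma abs_L2_eq_iff:
  assumes "L2_fun f" "L2_fun g"
  shows "abs_L2 f = abs_L2 g \<longleftrightarrow> (AE x in lebesgue_on {0..1}. f x = g x)"
  using Quotient3_rel[OF Quotient3_L2, of f g] assms by (auto simp: L2_rel_def)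

lemma L2_fun_rep_L2: "L2_fun (rep_L2 f)"
  using Quotient3_rep_reflp[OF Quotient3_L2, of f] by (simp add: L2_rel_def)

lemma abs_rep_L2: "abs_L2 (rep_L2 f) = f"
  by (rule Quotient3_abs_rep[OF Quotient3_L2])

lemma abs_L2_eq_0_iff:
  assumes "L2_fun f"
  shows "abs_L2 f = 0 \<longleftrightarrow> (AE x in lebesgue_on {0..1}. f x = 0)"
  using abs_L2_eq_iff[OF assms L2_fun_zero] by (simp add: zero_L2_def)

text \<open>This is what makes \<open>weak_deriv\<close> and the values of \<open>cont_rep\<close>
  on \<open>{0..1}\<close> well defined. Continuity upgrades equality almost everywhere of
  \<open>F\<close> and \<open>G\<close> to equality on \<open>{0..1}\<close>; then
  \<open>v - w\<close> integrates to zero over every \<open>{0..x}\<close>.\<close>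

lemma H1_pair_unique:
  assumes F: "H1_pair F v" and G: "H1_pair G w" and eq: "abs_L2 F = abs_L2 G"
  shows "x \<in> {0..1} \<Longrightarrow> F x = G x" and "abs_L2 v = abs_L2 w"
proof -
  have ae: "AE x in lebesgue_on {0..1}. F x = G x"
    using eq abs_L2_eq_iff L2_fun_H1_pair(1) F G by blast
  have FG: "F x = G x" if "x \<in> {0..1}" for x
    using continuous_AE_eq[OF continuous_on_H1_pair[OF F] continuous_on_H1_pair[OF G] ae that] .
  then show "x \<in> {0..1} \<Longrightarrow> F x = G x" .
  have vw: "v absolutely_integrable_on {0..1}" "w absolutely_integrable_on {0..1}"
    using F G L2_fun_H1_pair(2) L2_fun_absolutely_integrable by blast+
  have "integral {0..x} (\<lambda>t. v t - w t) = 0" if x: "x \<in> {0..1}" for x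
  proof -
    have "v integrable_on {0..x}" "w integrable_on {0..x}"
      using vw[THEN set_lebesgue_integral_eq_integral(1)] x
      by (auto intro: integrable_on_subinterval)
    then have "integral {0..x} (\<lambda>t. v t - w t) = integral {0..x} v - integral {0..x} w"
      by (rule Henstock_Kurzweil_Integration.integral_diff)
    with FG[of 0] FG[OF x] H1_pair_integral[OF F x] H1_pair_integral[OF G x] show ?thesis
      by simp
  qed
  then have "AE x in lebesgue_on {0..1}. v x - w x = 0"
    by (intro AE_zero_if_integrals_zero set_integral_diff(1)[OF vw])
  then show "abs_L2 v = abs_L2 w"
    using abs_L2_eq_iff F G L2_fun_H1_pair(2) by auto
qed

lemma weak_deriv_abs_L2:
  assumes "H1_pair F v"
  shows "weak_deriv (abs_L2 F) = abs_L2 v"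
  unfolding weak_deriv_def
proof (rule the_equality)
  show "\<exists>G w. H1_pair G w \<and> abs_L2 F = abs_L2 G \<and> abs_L2 v = abs_L2 w"
    using assms by blast
  show "f' = abs_L2 v" if "\<exists>G w. H1_pair G w \<and> abs_L2 F = abs_L2 G \<and> f' = abs_L2 w" for f'
    using that H1_pair_unique(2)[OF assms] by auto
qed

lemma cont_rep_abs_L2:
  assumes "H1_pair F v" "x \<in> {0..1}"
  shows "cont_rep (abs_L2 F) x = F x"
proof -
  have "\<exists>G. (\<exists>w. H1_pair G w) \<and> abs_L2 F = abs_L2 G"
    using assms by blast
  from someI_ex[OF this] obtain w where
    "H1_pair (cont_rep (abs_L2 F)) w" "abs_L2 F = abs_L2 (cont_rep (abs_L2 F))"
    unfolding cont_rep_def by blast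
  then show ?thesis
    using H1_pair_unique(1) assms by metis
qed

text \<open>The representative that \<open>rep_L2\<close> selects for the class of \<open>f\<close>
  differs from \<open>f\<close> only on a null set, so the product class may be computed from
  \<open>f\<close> itself.\<close>

lemma L2_mult_abs_L2:
  assumes q: "continuous_on {0..1} q" and f: "L2_fun f"
  shows "L2_mult q (abs_L2 f) = abs_L2 (\<lambda>x. q x * f x)"
proof -
  have "AE x in lebesgue_on {0..1}. rep_L2 (abs_L2 f) x = f x"
    using abs_L2_eq_iff[OF L2_fun_rep_L2 f] abs_rep_L2 by blast
  then show ?thesis
    unfolding L2_mult_def
    by (subst abs_L2_eq_iff) (auto intro!: L2_fun_continuous_mult assms L2_fun_rep_L2)
qed

text \<open>
  The defect of the chain rule over \<open>[a, b]\<close> is subadditive and locally at most \<open>e \<integral> \<bar>v\<bar>\<close> for every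
  \<open>e > 0\<close>, so a bisection argument makes it vanish.
\<close>

lemma H1_pair_chain:
  fixes \<Phi> \<Phi>' :: "real \<Rightarrow> real"
  assumes F: "H1_pair F v"
    and deriv: "\<And>x. x \<in> {0..1} \<Longrightarrow> (\<Phi> has_real_derivative \<Phi>' (F x)) (at (F x))"
    and cont: "continuous_on {0..1} (\<lambda>x. \<Phi>' (F x))"
  shows "H1_pair (\<lambda>x. \<Phi> (F x)) (\<lambda>x. \<Phi>' (F x) * v x)"
proof (rule H1_pairI)
  show L2: "L2_fun (\<lambda>x. \<Phi>' (F x) * v x)"
    using L2_fun_continuous_mult[OF cont] F L2_fun_H1_pair(2) by blast
  have int: "(\<lambda>x. \<bar>v x\<bar>) integrable_on {a..b}" "v integrable_on {a..b}"
    "(\<lambda>x. \<Phi>' (F x) * v x) integrable_on {a..b}" if "0 \<le> a" "b \<le> 1" for a b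
    using set_lebesgue_integral_eq_integral(1)[OF absolutely_integrable_abs[OF L2_fun_absolutely_integrable[OF L2_fun_H1_pair(2)[OF F]]]]
      set_lebesgue_integral_eq_integral(1)[OF L2_fun_absolutely_integrable[OF L2_fun_H1_pair(2)[OF F]]]
      set_lebesgue_integral_eq_integral(1)[OF L2_fun_absolutely_integrable[OF L2]] that
    by (auto intro: integrable_on_subinterval)
  have F_diff: "F b - F a = integral {a..b} v" if "0 \<le> a" "a \<le> b" "b \<le> 1" for a b
    using Henstock_Kurzweil_Integration.integral_combine[of 0 a b v] int(2)[of 0 b]
      H1_pair_integral[OF F, of a] H1_pair_integral[OF F, of b] that by simp
  have F_le: "\<bar>F b - F a\<bar> \<le> integral {a..b} (\<lambda>x. \<bar>v x\<bar>)" if "0 \<le> a" "a \<le> b" "b \<le> 1" for a b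
    using integral_norm_bound_integral[of v "{a..b}" "\<lambda>x. \<bar>v x\<bar>"] int(1,2)[of a b] F_diff[OF that] that
    by simp
  have bound: "\<bar>\<Phi> (F x) - \<Phi> (F 0) - integral {0..x} (\<lambda>x. \<Phi>' (F x) * v x)\<bar>
      \<le> e * integral {0..x} (\<lambda>x. \<bar>v x\<bar>)" if e: "e > 0" and x: "x \<in> {0..1}" for e x
  proof -
    \<comment> \<open>The premises \<open>0 \<le> a\<close> and \<open>b \<le> 1\<close> sit inside
      \<open>P\<close> because the local condition of the bisection principle also ranges over
      intervals that leave \<open>{0..1}\<close>.\<close>
    define P where "P a b \<longleftrightarrow> (0 \<le> a \<longrightarrow> b \<le> 1 \<longrightarrow>
      \<bar>\<Phi> (F b) - \<Phi> (F a) - integral {a..b} (\<lambda>x. \<Phi>' (F x) * v x)\<bar>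
        \<le> e * integral {a..b} (\<lambda>x. \<bar>v x\<bar>))" for a b
    have "P 0 x"
    proof (rule Bolzano)
      show "0 \<le> x" using x by simp
    next
      fix a b c assume P: "P a b" "P b c" and abc: "a \<le> b" "b \<le> c"
      show "P a c"
        unfolding P_def
      proof (intro impI)
        assume ac: "0 \<le> a" "c \<le> 1"
        have "integral {a..c} (\<lambda>x. \<bar>v x\<bar>) = integral {a..b} (\<lambda>x. \<bar>v x\<bar>) + integral {b..c} (\<lambda>x. \<bar>v x\<bar>)"
          using Henstock_Kurzweil_Integration.integral_combine[OF abc int(1)] ac by simp
        moreover have "integral {a..c} (\<lambda>x. \<Phi>' (F x) * v x) =
            integral {a..b} (\<lambda>x. \<Phi>' (F x) * v x) + integral {b..c} (\<lambda>x. \<Phi>' (F x) * v x)"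
          using Henstock_Kurzweil_Integration.integral_combine[OF abc int(3)] ac by simp
        ultimately show "\<bar>\<Phi> (F c) - \<Phi> (F a) - integral {a..c} (\<lambda>x. \<Phi>' (F x) * v x)\<bar>
            \<le> e * integral {a..c} (\<lambda>x. \<bar>v x\<bar>)"
          using P abc ac by (auto simp: P_def distrib_left)
      qed
    next
      fix y assume "0 \<le> y" "y \<le> x"
      with x have y: "y \<in> {0..1}" by auto
      have "(\<Phi> has_derivative (\<lambda>h. \<Phi>' (F y) * h)) (at (F y))"
        using deriv[OF y] by (simp add: has_field_derivative_def)
      \<comment> \<open>The tolerance \<open>e\<close> is split in two halves. The radii
        \<open>d1\<close> and \<open>d2\<close> control the linearization of \<Phi> at
        \<open>F y\<close> at both ends of a short interval around \<open>y\<close>;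
        \<open>d3\<close> controls the variation of \<open>\<Phi>' (F t)\<close> under the
        integral.\<close>
      then obtain d1 where d1: "d1 > 0" "\<And>z. \<bar>z - F y\<bar> < d1 \<Longrightarrow>
          \<bar>\<Phi> z - \<Phi> (F y) - \<Phi>' (F y) * (z - F y)\<bar> \<le> e / 2 * \<bar>z - F y\<bar>"
        using e unfolding has_derivative_at_alt by (metis half_gt_zero real_norm_def)
      obtain d2 where d2: "d2 > 0" "\<And>t. t \<in> {0..1} \<Longrightarrow> \<bar>t - y\<bar> < d2 \<Longrightarrow> \<bar>F t - F y\<bar> < d1"
        using continuous_on_H1_pair[OF F] y d1(1) unfolding continuous_on_iff dist_real_def by metis
      obtain d3 where d3: "d3 > 0" "\<And>t. t \<in> {0..1} \<Longrightarrow> \<bar>t - y\<bar> < d3 \<Longrightarrow> \<bar>\<Phi>' (F t) - \<Phi>' (F y)\<bar> < e / 2"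
        using cont y e unfolding continuous_on_iff dist_real_def by (metis half_gt_zero)
      have "P a b" if ab: "a \<le> y" "y \<le> b" "b - a < min d2 d3" for a b
        unfolding P_def
      proof (intro impI)
        assume ab': "0 \<le> a" "b \<le> 1"
        have 1: "\<bar>\<Phi> (F b) - \<Phi> (F y) - \<Phi>' (F y) * (F b - F y)\<bar> \<le> e / 2 * integral {y..b} (\<lambda>x. \<bar>v x\<bar>)"
          using d1(2)[OF d2(2)[of b]] F_le[of y b] ab ab' y e
          by (auto intro: order_trans[OF _ mult_left_mono])
        have 2: "\<bar>\<Phi> (F a) - \<Phi> (F y) - \<Phi>' (F y) * (F a - F y)\<bar> \<le> e / 2 * integral {a..y} (\<lambda>x. \<bar>v x\<bar>)"
          using d1(2)[OF d2(2)[of a]] F_le[of a y] ab ab' y e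
          by (auto intro: order_trans[OF _ mult_left_mono] simp: abs_minus_commute)
        have "norm (integral {a..b} (\<lambda>x. \<Phi>' (F x) * v x - \<Phi>' (F y) * v x))
            \<le> integral {a..b} (\<lambda>x. e / 2 * \<bar>v x\<bar>)"
        proof (rule integral_norm_bound_integral)
          show "(\<lambda>x. \<Phi>' (F x) * v x - \<Phi>' (F y) * v x) integrable_on {a..b}"
            using int(2,3)[OF ab'] by (intro integrable_diff integrable_on_mult_right)
          show "(\<lambda>x. e / 2 * \<bar>v x\<bar>) integrable_on {a..b}"
            using int(1)[OF ab'] by (rule integrable_on_mult_right)
          fix t assume t: "t \<in> {a..b}"
          have "\<bar>t - y\<bar> < d3"
            using t ab by (auto simp: abs_less_iff)
          then have "\<bar>\<Phi>' (F t) - \<Phi>' (F y)\<bar> \<le> e / 2"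
            using d3(2)[of t] t ab' by auto
          then show "norm (\<Phi>' (F t) * v t - \<Phi>' (F y) * v t) \<le> e / 2 * \<bar>v t\<bar>"
            unfolding left_diff_distrib[symmetric] real_norm_def abs_mult
            by (rule mult_right_mono) simp
        qed
        also have "integral {a..b} (\<lambda>x. \<Phi>' (F x) * v x - \<Phi>' (F y) * v x) =
            integral {a..b} (\<lambda>x. \<Phi>' (F x) * v x) - \<Phi>' (F y) * (F b - F a)"
          using int(2,3)[OF ab'] F_diff[of a b] ab ab'
          by (subst Henstock_Kurzweil_Integration.integral_diff) (auto intro: integrable_on_mult_right)
        finally have 3: "\<bar>integral {a..b} (\<lambda>x. \<Phi>' (F x) * v x) - \<Phi>' (F y) * (F b - F a)\<bar>
            \<le> e / 2 * integral {a..b} (\<lambda>x. \<bar>v x\<bar>)"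
          by simp
        have 4: "integral {a..b} (\<lambda>x. \<bar>v x\<bar>) = integral {a..y} (\<lambda>x. \<bar>v x\<bar>) + integral {y..b} (\<lambda>x. \<bar>v x\<bar>)"
          using Henstock_Kurzweil_Integration.integral_combine[OF ab(1,2) int(1)] ab' by simp
        \<comment> \<open>The linear terms of 1 and 2 combine to
          \<open>\<Phi>' (F y) * (F b - F a)\<close>, which cancels against 3. By 4, the errors of 1
          and 2 add up to one half of the allowed bound, and 3 contributes the other half.\<close>
        show "\<bar>\<Phi> (F b) - \<Phi> (F a) - integral {a..b} (\<lambda>x. \<Phi>' (F x) * v x)\<bar>
            \<le> e * integral {a..b} (\<lambda>x. \<bar>v x\<bar>)"
          using 1 2 3 unfolding 4 abs_le_iff by (auto simp: algebra_simps)
      qed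
      then show "\<exists>d>0. \<forall>a b. a \<le> y \<and> y \<le> b \<and> b - a < d \<longrightarrow> P a b"
        using d2(1) d3(1) by (intro exI[of _ "min d2 d3"]) auto
    qed
    then show ?thesis
      using x by (simp add: P_def)
  qed
  show "\<Phi> (F x) = \<Phi> (F 0) + integral {0..x} (\<lambda>x. \<Phi>' (F x) * v x)" if x: "x \<in> {0..1}" for x
  proof -
    \<comment> \<open>The defect does not depend on \<open>e\<close>, so the bound passes to the
      limit as \<open>e\<close> decreases to zero.\<close>
    have "((\<lambda>e. e * integral {0..x} (\<lambda>x. \<bar>v x\<bar>)) \<longlongrightarrow> 0 * integral {0..x} (\<lambda>x. \<bar>v x\<bar>)) (at_right 0)"
      by (intro tendsto_intros)
    then have "\<bar>\<Phi> (F x) - \<Phi> (F 0) - integral {0..x} (\<lambda>x. \<Phi>' (F x) * v x)\<bar>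
        \<le> 0 * integral {0..x} (\<lambda>x. \<bar>v x\<bar>)"
      by (rule tendsto_lowerbound)
        (use bound[OF _ x] in \<open>auto simp: eventually_at_right_field intro!: exI[of _ 1]\<close>)
    then show ?thesis by simp
  qed
qed

section \<open>Linear combinations, products and changes on null sets\<close>

lemma H1_pair_scale: "H1_pair F v \<Longrightarrow> H1_pair (\<lambda>x. k * F x) (\<lambda>x. k * v x)"
  by (rule H1_pair_chain) (auto intro!: derivative_eq_intros)

lemma H1_pair_add:
  assumes F: "H1_pair F v" and G: "H1_pair G w"
  shows "H1_pair (\<lambda>x. F x + G x) (\<lambda>x. v x + w x)"
proof (rule H1_pairI)
  show "L2_fun (\<lambda>x. v x + w x)"
    using F G L2_fun_H1_pair(2) L2_fun_add by blast
  fix x :: real assume x: "x \<in> {0..1}"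
  have "v integrable_on {0..1}" "w integrable_on {0..1}"
    using L2_fun_absolutely_integrable[OF L2_fun_H1_pair(2), THEN set_lebesgue_integral_eq_integral(1)] F G
    by blast+
  then have "v integrable_on {0..x}" "w integrable_on {0..x}"
    using x by (auto intro: integrable_on_subinterval)
  then have "integral {0..x} (\<lambda>x. v x + w x) = integral {0..x} v + integral {0..x} w"
    by (rule Henstock_Kurzweil_Integration.integral_add)
  then show "F x + G x = F 0 + G 0 + integral {0..x} (\<lambda>x. v x + w x)"
    using H1_pair_integral[OF F x] H1_pair_integral[OF G x] by simp
qed

lemma H1_pair_mult:
  assumes F: "H1_pair F v" and G: "H1_pair G w"
  shows "H1_pair (\<lambda>x. F x * G x) (\<lambda>x. F x * w x + v x * G x)"
proof -
  have sq: "H1_pair (\<lambda>x. (E x)\<^sup>2) (\<lambda>x. 2 * E x * u x)" if "H1_pair E u" for E u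
    by (rule H1_pair_chain[OF that])
      (auto intro!: derivative_eq_intros continuous_intros continuous_on_H1_pair[OF that])
  \<comment> \<open>Polarization reduces the product to squares.\<close>
  have "H1_pair (\<lambda>x. 1/4 * (F x + G x)\<^sup>2 + (-1/4) * (F x + -1 * G x)\<^sup>2)
      (\<lambda>x. 1/4 * (2 * (F x + G x) * (v x + w x)) + (-1/4) * (2 * (F x + -1 * G x) * (v x + -1 * w x)))"
    by (intro H1_pair_add H1_pair_scale sq F G)
  moreover have "(\<lambda>x. 1/4 * (F x + G x)\<^sup>2 + (-1/4) * (F x + -1 * G x)\<^sup>2) = (\<lambda>x. F x * G x)"
    by (auto simp: power2_eq_square field_simps)
  moreover have "(\<lambda>x. 1/4 * (2 * (F x + G x) * (v x + w x)) + (-1/4) * (2 * (F x + -1 * G x) * (v x + -1 * w x)))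
      = (\<lambda>x. F x * w x + v x * G x)"
    by (auto simp: field_simps)
  ultimately show ?thesis by simp
qed

text \<open>Integrals ignore null sets. This allows a weak derivative to be replaced by its
  continuous representative, or by zero when it vanishes almost everywhere.\<close>

lemma H1_pair_cong_AE:
  assumes F: "H1_pair F v" and w: "L2_fun w" and ae: "AE x in lebesgue_on {0..1}. v x = w x"
  shows "H1_pair F w"
  unfolding H1_pair_def
proof (intro conjI ballI w)
  show "L2_fun F" using F by (rule L2_fun_H1_pair)
  fix x :: real assume x: "x \<in> {0..1}"
  have int: "u \<in> borel_measurable (lebesgue_on {0..x})" if "L2_fun u" for u
    using set_integrable_subset[OF L2_fun_absolutely_integrable[OF that], of "{0..x}"] x
    by (auto simp: absolutely_integrable_on_iff_integrable_lebesgue_on)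
  have "AE t in lebesgue_on {0..x}. v t = w t"
    using ae x by (auto simp: AE_restrict_space_iff)
  then have "integral\<^sup>L (lebesgue_on {0..x}) v = integral\<^sup>L (lebesgue_on {0..x}) w"
    using L2_fun_H1_pair(2)[OF F] w by (intro Bochner_Integration.integral_cong_AE int)
  then show "F x = F 0 + integral\<^sup>L (lebesgue_on {0..x}) w"
    using F x unfolding H1_pair_def by metis
qed

section \<open>Null vectors of the linearized operator\<close>

text \<open>The assumption on the cube of \<open>a\<close> lets the product rule apply to
  \<open>a\<^sup>3 \<phi>'\<close>, so that a vanishing weak derivative really forces this flux to
  be constant.\<close>

lemma lin_op_zero_eigenvalue:
  assumes a: "continuous_on {0..1} a" "\<And>x. x \<in> {0..1} \<Longrightarrow> a x > 0"
    and a3: "H1_pair (\<lambda>x. a x ^ 3) q"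
    and "\<beta> \<noteq> 0" and ev: "is_eigenvalue lin_dom (lin_op a \<beta> \<alpha>) 0"
  shows "\<alpha> * integral {0..1} (\<lambda>x. 1 / a x ^ 3) = 1"
proof -
  obtain \<rho> \<tau> \<phi> w where dom: "(\<rho>, \<tau>, \<phi>, w) \<in> lin_dom" and nz: "(\<rho>, \<tau>, \<phi>, w) \<noteq> 0"
    and z: "lin_op a \<beta> \<alpha> (\<rho>, \<tau>, \<phi>, w) = 0"
    using ev unfolding is_eigenvalue_def by (auto simp: prod_eq_iff)
  have \<phi>: "\<phi> \<in> H1" "weak_deriv \<phi> \<in> H1" "cont_rep \<phi> 0 = 0" "cont_rep \<phi> 1 = \<rho>"
    using dom by (auto simp: lin_dom_def state_space_def H2_def)
  have z1: "\<tau> / a 1 = 0"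
    and z2: "a 1 ^ 4 / \<beta> * cont_rep (weak_deriv \<phi>) 1 - a 1 * \<alpha> / \<beta> * \<rho> = 0"
    and z3: "L2_mult (\<lambda>x. - (1 / a x)) w = 0"
    and z4: "weak_deriv (L2_mult (\<lambda>x. a x ^ 3) (weak_deriv \<phi>)) = 0"
    using z by (auto simp: lin_op_def zero_prod_def)
  have a_neq: "a x \<noteq> 0" if "x \<in> {0..1}" for x
    using a(2)[OF that] by simp
  have "w = 0"
  proof -
    have c: "continuous_on {0..1} (\<lambda>x. - (1 / a x))"
      using a_neq by (intro continuous_intros a) auto
    have "AE x in lebesgue_on {0..1}. - (1 / a x) * rep_L2 w x = 0"
      using z3 abs_L2_eq_0_iff[OF L2_fun_continuous_mult[OF c L2_fun_rep_L2]]
      by (simp add: L2_mult_def)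
    then have "AE x in lebesgue_on {0..1}. rep_L2 w x = 0"
      by (rule AE_mp) (use a_neq in \<open>auto intro!: AE_I2\<close>)
    then show ?thesis
      using abs_L2_eq_0_iff[OF L2_fun_rep_L2] abs_rep_L2 by metis
  qed
  have "\<tau> = 0"
    using z1 a_neq[of 1] by simp
  obtain F v where F: "H1_pair F v" "\<phi> = abs_L2 F"
    using \<phi>(1) by (auto simp: H1_def)
  have wd: "weak_deriv \<phi> = abs_L2 v"
    using F weak_deriv_abs_L2 by simp
  obtain P p where P: "H1_pair P p" "abs_L2 v = abs_L2 P"
    using \<phi>(2) by (auto simp: H1_def wd)
  \<comment> \<open>From here on the continuous function \<open>P\<close> serves as the derivative
    of \<open>F\<close>; its pointwise values give meaning to the boundary condition at 1.\<close>
  have F_P: "H1_pair F P"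
    using H1_pair_cong_AE[OF F(1)] P abs_L2_eq_iff L2_fun_H1_pair F(1) by blast
  have c3: "continuous_on {0..1} (\<lambda>x. a x ^ 3)"
    by (intro continuous_intros a)
  have aP: "H1_pair (\<lambda>x. a x ^ 3 * P x) (\<lambda>x. a x ^ 3 * p x + q x * P x)"
    by (rule H1_pair_mult[OF a3 P(1)])
  have "weak_deriv (abs_L2 (\<lambda>x. a x ^ 3 * P x)) = 0"
    using z4 unfolding wd P(2) L2_mult_abs_L2[OF c3 L2_fun_H1_pair(1)[OF P(1)]] .
  then have "abs_L2 (\<lambda>x. a x ^ 3 * p x + q x * P x) = 0"
    using weak_deriv_abs_L2[OF aP] by simp
  then have "AE x in lebesgue_on {0..1}. a x ^ 3 * p x + q x * P x = 0"
    using abs_L2_eq_0_iff[OF L2_fun_H1_pair(2)[OF aP]] by blast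
  then have "H1_pair (\<lambda>x. a x ^ 3 * P x) (\<lambda>x. 0)"
    by (intro H1_pair_cong_AE[OF aP] L2_fun_zero)
  \<comment> \<open>A function whose weak derivative is zero is constant.\<close>
  then have K: "a x ^ 3 * P x = a 0 ^ 3 * P 0" if "x \<in> {0..1}" for x
    using H1_pair_integral[of _ _ x] that by fastforce
  define K where "K = a 0 ^ 3 * P 0"
  have P_eq: "P x = K * (1 / a x ^ 3)" if "x \<in> {0..1}" for x
    using K[OF that] a_neq[OF that] by (simp add: K_def field_simps)
  have F_bd: "F 0 = 0" "F 1 = \<rho>"
    using \<phi>(3,4) cont_rep_abs_L2[OF F(1)] F(2) by auto
  have "integral {0..1} P = integral {0..1} (\<lambda>x. K * (1 / a x ^ 3))"
    by (rule integral_cong) (rule P_eq)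
  then have \<rho>: "\<rho> = K * integral {0..1} (\<lambda>x. 1 / a x ^ 3)"
    using H1_pair_integral[OF F_P, of 1] F_bd integral_mult_right[of "{0..1}" K] by (simp del: times_divide_eq_right)
  have "cont_rep (weak_deriv \<phi>) 1 = P 1"
    using cont_rep_abs_L2[OF P(1)] by (simp add: wd P(2))
  \<comment> \<open>With \<open>a 1 ^ 3 * P 1 = K\<close>, the second component becomes
    \<open>a 1 / \<beta> * (K - \<alpha> * \<rho>) = 0\<close>.\<close>
  then have "K = \<alpha> * \<rho>"
    using z2 P_eq[of 1] a_neq[of 1] \<open>\<beta> \<noteq> 0\<close> by (simp add: field_simps eval_nat_numeral)
  \<comment> \<open>Otherwise \<open>P\<close> vanishes, hence also \<open>F\<close> and \<rho>, and
    the null vector would be zero. This permits cancelling \<open>K\<close> in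
    \<open>K = \<alpha> * K * integral {0..1} (\<lambda>x. 1 / a x ^ 3)\<close>.\<close>
  moreover have "K \<noteq> 0"
  proof
    assume "K = 0"
    have "F x = 0" if x: "x \<in> {0..1}" for x
    proof -
      have "integral {0..x} P = integral {0..x} (\<lambda>x. 0)"
        by (rule integral_cong) (use P_eq x \<open>K = 0\<close> in auto)
      then show ?thesis
        using H1_pair_integral[OF F_P x] F_bd by simp
    qed
    then have "\<phi> = 0"
      using F abs_L2_eq_0_iff[OF L2_fun_H1_pair(1)[OF F(1)]] by (auto intro!: AE_I2)
    then show False
      using nz \<rho> \<open>K = 0\<close> \<open>\<tau> = 0\<close> \<open>w = 0\<close> by (simp add: zero_prod_def)
  qed
  ultimately show ?thesis
    using \<rho> by (simp add: field_simps)
qed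

section \<open>Laminar flows\<close>

lemma flow_a_pos:
  assumes "laminar_flow \<gamma> lam" "x \<in> {0..1}"
  shows "flow_a \<gamma> lam x > 0"
  using assms by (simp add: laminar_flow_def flow_a_def)

lemma H1_pair_Gam:
  assumes "laminar_flow \<gamma> lam"
  shows "H1_pair (\<lambda>x. lam + 2 * Gam \<gamma> x) (\<lambda>x. 2 * \<gamma> x)"
proof (rule H1_pairI)
  have \<gamma>: "L2_fun \<gamma>"
    using assms by (simp add: laminar_flow_def)
  then show "L2_fun (\<lambda>x. 2 * \<gamma> x)" by (rule L2_fun_scale)
  show "lam + 2 * Gam \<gamma> x = lam + 2 * Gam \<gamma> 0 + integral {0..x} (\<lambda>x. 2 * \<gamma> x)" if "x \<in> {0..1}" for x
    using that lebesgue_on_integral_eq[OF L2_fun_absolutely_integrable[OF \<gamma>], of 0]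
      lebesgue_on_integral_eq[OF L2_fun_absolutely_integrable[OF \<gamma>], of x]
    by (simp add: Gam_def)
qed

lemma continuous_on_flow_a:
  assumes "laminar_flow \<gamma> lam"
  shows "continuous_on {0..1} (flow_a \<gamma> lam)"
  using continuous_on_real_sqrt[OF continuous_on_H1_pair[OF H1_pair_Gam[OF assms]]]
  by (simp add: flow_a_def[abs_def])

text \<open>The cube of \<open>a\<close> is the power 3/2 of
  \<open>lam + 2 * Gam \<gamma> x\<close>, which stays positive on \<open>{0..1}\<close>, where that
  power is continuously differentiable.\<close>

lemma H1_pair_flow_a_cube:
  assumes "laminar_flow \<gamma> lam"
  shows "\<exists>q. H1_pair (\<lambda>x. flow_a \<gamma> lam x ^ 3) q"
proof -
  have pos: "lam + 2 * Gam \<gamma> x > 0" if "x \<in> {0..1}" for x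
    using assms that by (simp add: laminar_flow_def)
  \<comment> \<open>The derivative is \<open>3 * a * \<gamma>\<close>, left in the unsimplified
    shape that the chain rule produces.\<close>
  have "H1_pair (\<lambda>x. sqrt (lam + 2 * Gam \<gamma> x) ^ 3)
     (\<lambda>x. 3 * sqrt (lam + 2 * Gam \<gamma> x) ^ 2 * (inverse (sqrt (lam + 2 * Gam \<gamma> x)) / 2) * (2 * \<gamma> x))"
  proof (rule H1_pair_chain[OF H1_pair_Gam[OF assms], where \<Phi> = "\<lambda>y. sqrt y ^ 3"
        and \<Phi>' = "\<lambda>y. 3 * sqrt y ^ 2 * (inverse (sqrt y) / 2)"])
    show "((\<lambda>y. sqrt y ^ 3) has_real_derivative
        3 * (sqrt (lam + 2 * Gam \<gamma> x))\<^sup>2 * (inverse (sqrt (lam + 2 * Gam \<gamma> x)) / 2))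
        (at (lam + 2 * Gam \<gamma> x))" if "x \<in> {0..1}" for x
      using pos[OF that] by (auto intro!: derivative_eq_intros)
    have "sqrt (lam + 2 * Gam \<gamma> x) \<noteq> 0" if "x \<in> {0..1}" for x
      using pos[OF that] by simp
    then show "continuous_on {0..1}
        (\<lambda>x. 3 * (sqrt (lam + 2 * Gam \<gamma> x))\<^sup>2 * (inverse (sqrt (lam + 2 * Gam \<gamma> x)) / 2))"
      by (intro continuous_intros continuous_on_H1_pair[OF H1_pair_Gam[OF assms]]) auto
  qed
  then show ?thesis
    unfolding flow_a_def by blast
qed

section \<open>The minimum of the velocity profile and the lower bound on gravity\<close>

lemma flow_a_INF_attained:
  assumes "laminar_flow \<gamma> lam"
  obtains x where "x \<in> {0..1}" "(INF \<zeta>\<in>{0..1}. flow_a \<gamma> lam \<zeta>) = flow_a \<gamma> lam x"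
    "\<And>y. y \<in> {0..1} \<Longrightarrow> flow_a \<gamma> lam x \<le> flow_a \<gamma> lam y"
proof -
  obtain x where x: "x \<in> {0..1}" "\<And>y. y \<in> {0..1} \<Longrightarrow> flow_a \<gamma> lam x \<le> flow_a \<gamma> lam y"
    using continuous_attains_inf[OF _ _ continuous_on_flow_a[OF assms]] by auto
  then have "(INF \<zeta>\<in>{0..1}. flow_a \<gamma> lam \<zeta>) = flow_a \<gamma> lam x"
    by (intro cInf_eq_minimum) auto
  with x that show thesis by blast
qed

text \<open>The factor \<open>d ^ 3 / m\<^sup>2\<close> is the ratio of \<alpha> to the effective
  gravity, so this is the bound \<open>(min a)\<^sup>3 \<le> \<alpha>\<close> in dimensional
  form.\<close>

lemma flow_a_INF_cube_le:
  assumes flow: "laminar_flow \<gamma> lam" and "d > 0" "m < 0" "\<sigma> > 0"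
    and crit: "critical_speed g \<Omega> d m \<sigma> (flow_a \<gamma> lam) c"
  shows "(INF \<zeta>\<in>{0..1}. flow_a \<gamma> lam \<zeta>) ^ 3 \<le> eff_gravity g \<Omega> c * (d ^ 3 / m\<^sup>2)"
proof -
  let ?a = "flow_a \<gamma> lam"
  define \<alpha> where "\<alpha> = alpha_par g \<Omega> d m c"
  define I where "I = integral {0..1} (\<lambda>x. 1 / ?a x ^ 3)"
  have pos: "?a x > 0" if "x \<in> {0..1}" for x
    using flow_a_pos[OF flow that] .
  obtain x where x: "x \<in> {0..1}" "(INF \<zeta>\<in>{0..1}. ?a \<zeta>) = ?a x"
    "\<And>y. y \<in> {0..1} \<Longrightarrow> ?a x \<le> ?a y"
    using flow_a_INF_attained[OF flow] by blast
  obtain q where "H1_pair (\<lambda>x. ?a x ^ 3) q"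
    using H1_pair_flow_a_cube[OF flow] by blast
  moreover have "beta_par \<sigma> d m \<noteq> 0"
    using \<open>d > 0\<close> \<open>m < 0\<close> \<open>\<sigma> > 0\<close> by (simp add: beta_par_def)
  moreover have "is_eigenvalue lin_dom (lin_op ?a (beta_par \<sigma> d m) \<alpha>) 0"
    using crit by (simp add: critical_speed_def zero_sq_resonance_def \<alpha>_def)
  ultimately have \<alpha>I: "\<alpha> * I = 1"
    unfolding I_def using lin_op_zero_eigenvalue[OF continuous_on_flow_a[OF flow] pos] by blast
  have nz: "?a y \<noteq> 0" if "y \<in> {0..1}" for y
    using pos[OF that] by simp
  have int: "(\<lambda>x. 1 / ?a x ^ 3) integrable_on {0..1}"
    using nz by (intro integrable_continuous_interval continuous_intros continuous_on_flow_a[OF flow]) auto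
  have "0 \<le> I"
    unfolding I_def by (rule integral_nonneg[OF int]) (use pos in \<open>auto intro: less_imp_le\<close>)
  have "I \<le> integral {0..1} (\<lambda>_::real. 1 / ?a x ^ 3)"
    unfolding I_def
  proof (rule integral_le[OF int])
    show "1 / ?a y ^ 3 \<le> 1 / ?a x ^ 3" if "y \<in> {0..1}" for y
      using x(3)[OF that] pos[OF x(1)] by (intro divide_left_mono power_mono) auto
  qed auto
  then have "I * ?a x ^ 3 \<le> 1"
    using pos[OF x(1)] by (simp add: field_simps)
  \<comment> \<open>A negative \<alpha> would contradict \<open>\<alpha> * I = 1\<close>, because
    \<open>I\<close> is nonnegative.\<close>
  moreover have "0 \<le> \<alpha>"
    using \<alpha>I \<open>0 \<le> I\<close> by (metis mult_nonpos_nonneg nle_le not_one_le_zero)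
  ultimately have "\<alpha> * (I * ?a x ^ 3) \<le> \<alpha>"
    using mult_left_mono[of _ 1 \<alpha>] by simp
  then have "?a x ^ 3 \<le> \<alpha>"
    using \<alpha>I by (simp flip: mult.assoc)
  then show ?thesis
    by (simp add: x(2) \<alpha>_def alpha_par_def)
qed

section \<open>The physical velocity in terms of the velocity profile\<close>

text \<open>The inverse \<open>G\<close> of the height function satisfies
  \<open>G' = a (G s)\<close>; rescaling by \<open>s = (z + d) / d\<close> contributes the factor
  \<open>1 / d\<close>, and the stream function contributes \<open>- m\<close>. The open strip only
  sees streamlines with parameter in \<open>{0<..<1}\<close>, so a minimum of \<open>a\<close> at an
  endpoint is reached by continuity.\<close>

lemma horizontal_velocity_INF:
  assumes flow: "laminar_flow \<gamma> lam" and "d > 0" "m < 0"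
  shows "(INF p\<in>fluid_domain d. horizontal_velocity d m (flow_a \<gamma> lam) c p - c) =
    - m / d * (INF \<zeta>\<in>{0..1}. flow_a \<gamma> lam \<zeta>)"
proof -
  let ?a = "flow_a \<gamma> lam"
  define H where "H = height ?a"
  define G where "G = the_inv_into {0..1} H"
  note cont = continuous_on_flow_a[OF flow]
  have pos: "?a x > 0" if "x \<in> {0..1}" for x
    using flow_a_pos[OF flow that] .
  have nz: "?a x \<noteq> 0" if "x \<in> {0..1}" for x
    using pos[OF that] by simp
  have c: "continuous_on {0..1} (\<lambda>x. 1 / ?a x)"
    using nz by (intro continuous_intros cont) auto
  have H_eq: "H x = integral {0..x} (\<lambda>s. 1 / ?a s)" if "x \<in> {0..1}" for x
    unfolding H_def height_def
    using lebesgue_on_integral_eq[OF L2_fun_absolutely_integrable[OF L2_fun_continuous[OF c]] that] .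
  \<comment> \<open>The derivative is taken within the closed interval, hence one-sided at 0 and 1;
    only interior points are used later for two-sided derivatives.\<close>
  have der: "(H has_real_derivative 1 / ?a x) (at x within {0..1})" if "x \<in> {0..1}" for x
    by (rule has_field_derivative_transform_within[OF integral_has_real_derivative[OF c that] zero_less_one that])
      (simp add: H_eq)
  have contH: "continuous_on {0..1} H"
    using der by (rule DERIV_continuous_on)
  have mono: "H x < H y" if xy: "x \<in> {0..1}" "y \<in> {0..1}" "x < y" for x y
  proof (rule DERIV_pos_imp_increasing_open[OF xy(3)])
    fix t assume t: "x < t" "t < y"
    with xy have "t \<in> {0<..<1}" by auto
    then have "(H has_real_derivative 1 / ?a t) (at t)"
      using der[of t] at_within_interior[of t "{0..1}"] by auto
    then show "\<exists>D. (H has_real_derivative D) (at t) \<and> D > 0"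
      using pos[of t] \<open>t \<in> {0<..<1}\<close> by auto
  next
    show "continuous_on {x..y} H"
      by (rule continuous_on_subset[OF contH]) (use xy in auto)
  qed
  \<comment> \<open>The value at 1 is the normalization built into \<open>laminar_flow\<close>; it
    makes \<open>H\<close> a bijection of \<open>{0..1}\<close> onto itself.\<close>
  have H01: "H 0 = 0" "H 1 = 1"
    using H_eq[of 0] flow by (auto simp: laminar_flow_def H_def)
  have inj: "inj_on H {0..1}"
    by (rule linorder_inj_onI') (use mono in \<open>metis less_irrefl\<close>)
  have img: "H ` {0..1} = {0..1}"
  proof
    show "H ` {0..1} \<subseteq> {0..1}"
      using mono[of 0] mono[of _ 1] H01 by (force simp: le_less)
    show "{0..1} \<subseteq> H ` {0..1}"
      using IVT'[of H 0 _ 1] H01 contH by (force simp: image_iff)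
  qed
  have G: "G s \<in> {0<..<1}" "H (G s) = s" if s: "s \<in> {0<..<1}" for s
  proof -
    have s': "s \<in> H ` {0..1}"
      unfolding img using s by auto
    show HG: "H (G s) = s"
      unfolding G_def by (rule f_the_inv_into_f[OF inj s'])
    have "G s \<in> {0..1}"
      unfolding G_def by (rule the_inv_into_into[OF inj s' order_refl])
    moreover have "G s \<noteq> 0" "G s \<noteq> 1"
      using HG H01 s by auto
    ultimately show "G s \<in> {0<..<1}" by auto
  qed
  have contG: "continuous_on {0..1} G"
    using continuous_on_inv_into[OF contH compact_Icc inj] img by (simp add: G_def)
  have derG: "(G has_real_derivative ?a (G s)) (at s)" if s: "s \<in> {0<..<1}" for s
  proof -
    have "(H has_real_derivative 1 / ?a (G s)) (at (G s))"
      using der[of "G s"] at_within_interior[of "G s" "{0..1}"] G(1)[OF s] by auto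
    moreover have "1 / ?a (G s) \<noteq> 0"
      using nz[of "G s"] G(1)[OF s] by auto
    moreover have "isCont G s"
      using contG s by (simp add: continuous_on_interior)
    ultimately have "(G has_real_derivative inverse (1 / ?a (G s))) (at s)"
      using G(2) s by (intro DERIV_inverse_function[where f = H and a = 0 and b = 1]) auto
    then show ?thesis by simp
  qed
  have vel: "horizontal_velocity d m ?a c (x, z) - c = - m / d * ?a (G ((z + d) / d))"
    if z: "- d < z" "z < 0" for x z
  proof -
    have s: "(z + d) / d \<in> {0<..<1}"
      using z \<open>d > 0\<close> by (auto simp: field_simps)
    have "((\<lambda>y. G ((y + d) / d)) has_real_derivative ?a (G ((z + d) / d)) * (1 / d)) (at z)"
      by (rule DERIV_chain2[where f = G and g = "\<lambda>y. (y + d) / d", OF derG[OF s]]) (use \<open>d > 0\<close> in \<open>auto intro!: derivative_eq_intros\<close>)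
    then have "((\<lambda>y. m * (1 - G ((y + d) / d))) has_real_derivative
        - m / d * ?a (G ((z + d) / d))) (at z)"
      by (auto intro!: derivative_eq_intros)
    then show ?thesis
      by (simp add: horizontal_velocity_def stream_function_def G_def H_def DERIV_imp_deriv)
  qed
  obtain x where x: "x \<in> {0..1}" "(INF \<zeta>\<in>{0..1}. ?a \<zeta>) = ?a x"
    "\<And>y. y \<in> {0..1} \<Longrightarrow> ?a x \<le> ?a y"
    using flow_a_INF_attained[OF flow] by blast
  have k: "- m / d > 0"
    using \<open>d > 0\<close> \<open>m < 0\<close> by (simp add: divide_neg_pos)
  have "(INF p\<in>fluid_domain d. horizontal_velocity d m ?a c p - c) = - m / d * ?a x"
  proof (rule cInf_eq)
    fix u assume "u \<in> (\<lambda>p. horizontal_velocity d m ?a c p - c) ` fluid_domain d"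
    then obtain y z where z: "- d < z" "z < 0" and u: "u = - m / d * ?a (G ((z + d) / d))"
      using vel by (force simp: fluid_domain_def)
    have "(z + d) / d \<in> {0<..<1}"
      using z \<open>d > 0\<close> by (auto simp: field_simps)
    then have "?a x \<le> ?a (G ((z + d) / d))"
      using G(1) by (intro x(3)) force
    then show "- m / d * ?a x \<le> u"
      unfolding u using k by (intro mult_left_mono) auto
  next
    fix l assume l: "\<And>u. u \<in> (\<lambda>p. horizontal_velocity d m ?a c p - c) ` fluid_domain d \<Longrightarrow> l \<le> u"
    have "l \<le> - m / d * ?a \<zeta>" if \<zeta>: "\<zeta> \<in> {0<..<1}" for \<zeta>
    proof -
      \<comment> \<open>The level of the streamline with parameter \<zeta>, where the velocity
        realizes the value of \<open>a\<close> at \<zeta>.\<close>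
      define z where "z = d * H \<zeta> - d"
      have H\<zeta>: "0 < H \<zeta>" "H \<zeta> < 1"
        using mono[of 0 \<zeta>] mono[of \<zeta> 1] H01 \<zeta> by auto
      have z: "- d < z" "z < 0"
        using H\<zeta> \<open>d > 0\<close> by (auto simp: z_def)
      have "(z + d) / d = H \<zeta>"
        using \<open>d > 0\<close> by (simp add: z_def)
      moreover have "G (H \<zeta>) = \<zeta>"
        unfolding G_def by (rule the_inv_into_f_f[OF inj]) (use \<zeta> in auto)
      ultimately have "horizontal_velocity d m ?a c (0, z) - c = - m / d * ?a \<zeta>"
        using vel[OF z] by simp
      moreover have "(0, z) \<in> fluid_domain d"
        using z by (simp add: fluid_domain_def)
      ultimately show ?thesis
        using l by (metis image_eqI)
    qed
    \<comment> \<open>A lower bound on the open interval extends to its closure, which contains the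
      minimizer \<open>x\<close> even if it is 0 or 1.\<close>
    moreover have "continuous_on (closure {0<..<1}) (\<lambda>\<zeta>. - m / d * ?a \<zeta>)"
      using cont \<open>d > 0\<close> by (auto intro!: continuous_intros)
    ultimately show "l \<le> - m / d * ?a x"
      using continuous_ge_on_closure[of "{0<..<1}" "\<lambda>\<zeta>. - m / d * ?a \<zeta>" x l] x(1) by auto
  qed
  then show ?thesis
    by (simp add: x(2))
qed

text \<open>An arbitrary filter \<open>F\<close> on the index type expresses passage along a family,
  so sequences are covered as well as continuous parameters. The vorticity, the surface tension and
  the critical speed may vary with the member, while \<open>g\<close>, \<Omega>, \<open>d\<close>
  and \<open>m\<close> are fixed.\<close>

theorem theorem1p5:
  fixes g \<Omega> d m :: real
    and \<gamma> :: "'i \<Rightarrow> real \<Rightarrow> real"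
    and lam \<sigma> c :: "'i \<Rightarrow> real"
  assumes "d > 0" and "m < 0" and "\<And>i. \<sigma> i > 0"
    and "\<And>i. laminar_flow (\<gamma> i) (lam i)"
    and "\<And>i. critical_speed g \<Omega> d m (\<sigma> i) (flow_a (\<gamma> i) (lam i)) (c i)"
  shows "((\<exists>a_min>0. \<forall>i. \<forall>\<zeta>\<in>{0..1}. a_min \<le> flow_a (\<gamma> i) (lam i) \<zeta>) \<longrightarrow>
            (\<exists>\<delta>>0. \<forall>i. \<delta> \<le> \<bar>eff_gravity g \<Omega> (c i)\<bar>)) \<and>
         (\<forall>F :: 'i filter.
            (((\<lambda>i. eff_gravity g \<Omega> (c i)) \<longlongrightarrow> 0) F \<longrightarrow>
               ((\<lambda>i. INF \<zeta>\<in>{0..1}. flow_a (\<gamma> i) (lam i) \<zeta>) \<longlongrightarrow> 0) F) \<and>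
            (((\<lambda>i. INF \<zeta>\<in>{0..1}. flow_a (\<gamma> i) (lam i) \<zeta>) \<longlongrightarrow> 0) F \<longleftrightarrow>
               ((\<lambda>i. INF p\<in>fluid_domain d.
                   horizontal_velocity d m (flow_a (\<gamma> i) (lam i)) (c i) p - c i) \<longlongrightarrow> 0) F))"
proof (intro conjI impI allI)
  let ?M = "\<lambda>i. INF \<zeta>\<in>{0..1}. flow_a (\<gamma> i) (lam i) \<zeta>"
  let ?e = "\<lambda>i. eff_gravity g \<Omega> (c i)"
  have k: "d ^ 3 / m\<^sup>2 > 0"
    using assms(1,2) by simp
  have M: "?M i ^ 3 \<le> ?e i * (d ^ 3 / m\<^sup>2)" for i
    using flow_a_INF_cube_le[OF assms(4,1,2,3,5)] .
  have M_nonneg: "0 \<le> ?M i" for i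
    by (rule flow_a_INF_attained[OF assms(4)[of i]]) (use flow_a_pos[OF assms(4)] in \<open>force intro: less_imp_le\<close>)
  {
    assume "\<exists>a_min>0. \<forall>i. \<forall>\<zeta>\<in>{0..1}. a_min \<le> flow_a (\<gamma> i) (lam i) \<zeta>"
    then obtain a_min where a_min: "a_min > 0" "\<And>i \<zeta>. \<zeta> \<in> {0..1} \<Longrightarrow> a_min \<le> flow_a (\<gamma> i) (lam i) \<zeta>"
      by blast
    \<comment> \<open>The constant is \<open>a_min\<close> cubed, converted from \<alpha> to
      effective gravity by dividing by \<open>d ^ 3 / m\<^sup>2\<close>.\<close>
    have "a_min ^ 3 / (d ^ 3 / m\<^sup>2) \<le> \<bar>?e i\<bar>" for i
    proof -
      have "a_min \<le> ?M i"
        using a_min(2) by (intro cINF_greatest) auto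
      then have "a_min ^ 3 \<le> ?e i * (d ^ 3 / m\<^sup>2)"
        using M[of i] a_min(1) by (meson less_imp_le order_trans power_mono)
      also have "\<dots> \<le> \<bar>?e i\<bar> * (d ^ 3 / m\<^sup>2)"
        using k by (intro mult_right_mono) auto
      finally show ?thesis
        using k by (simp only: pos_divide_le_eq)
    qed
    then show "\<exists>\<delta>>0. \<forall>i. \<delta> \<le> \<bar>?e i\<bar>"
      using a_min(1) k by (intro exI[of _ "a_min ^ 3 / (d ^ 3 / m\<^sup>2)"] conjI divide_pos_pos[OF _ k]) auto
  }
  fix F :: "'i filter"
  \<comment> \<open>The minimum is squeezed between 0 and the cube root of a multiple of the
    effective gravity.\<close>
  show "(?M \<longlongrightarrow> 0) F" if e: "(?e \<longlongrightarrow> 0) F"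
  proof (rule tendsto_sandwich)
    show "\<forall>\<^sub>F i in F. 0 \<le> ?M i"
      using M_nonneg by simp
    show "\<forall>\<^sub>F i in F. ?M i \<le> root 3 (?e i * (d ^ 3 / m\<^sup>2))"
      using real_root_le_mono[OF _ M, of 3] M_nonneg by (simp add: real_root_power_cancel)
    show "((\<lambda>i. root 3 (?e i * (d ^ 3 / m\<^sup>2))) \<longlongrightarrow> 0) F"
      using tendsto_real_root[OF tendsto_mult_right[OF e, of "d ^ 3 / m\<^sup>2"], of 3] by simp
  qed simp
  show "(?M \<longlongrightarrow> 0) F \<longleftrightarrow> ((\<lambda>i. INF p\<in>fluid_domain d.
      horizontal_velocity d m (flow_a (\<gamma> i) (lam i)) (c i) p - c i) \<longlongrightarrow> 0) F"
    \<comment> \<open>The two infima differ by the fixed nonzero factor \<open>- m / d\<close>, so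
      they tend to zero together.\<close>
    using tendsto_mult_left_iff[of "- m / d" ?M 0 F] assms(1,2)
    by (simp add: horizontal_velocity_INF[OF assms(4,1,2)])
qed

end
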